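(* (a) For every integer $j\geqslant1$, the periodic word ${\tt w}=({\tt a}^j{\tt b}^j)^\omega$ satisfies $r(n)=j$ for all $n\geqslant1$. (b) Let $k,j$ be integers with $0\leqslant j\leqslant k-1$ and let ${\tt w}$ be the one-sided fixed point of $\sigma_{k-j,j,1}$. Then $r(n)=kn-j$ for all $n\geqslant1$. (c) Let $k\geqslant1$ be an integer and ${\tt w}$ the one-sided fixed point of $\sigma_{1,k-1,1}$. Then $r_{D({\tt w})}(n)=kn+1$ for all $n\geqslant1$.
   Context: For integers $k,m\geqslant1$, $l\geqslant0$, $\sigma_{k,l,m}$ is the substitution ${\tt a}\mapsto{\tt a}^k{\tt b}{\tt a}^l,\ {\tt b}\mapsto{\tt a}^m$; its one-sided fixed point is the limit of $\sigma_{k,l,m}^n({\tt a})$. $({\tt a}^j{\tt b}^j)^\omega$ is the infinite periodic repetition of ${\tt a}^j{\tt b}^j$. $D$ deletes the first ${\tt a}$ and the first ${\tt b}$ of a word. Words are indexed from position $0$; $p_{\tt a}(n)$, $p_{\tt b}(n)$ are the positions of the $n$-th ${\tt a}$ and $n$-th ${\tt b}$ and $r(n)=r_{\tt w}(n)=p_{\tt b}(n)-p_{\tt a}(n)$. *)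

theory Defs
  imports "HOL-Library.Omega_Words_Fun" "HOL-Library.Sublist" Complex_Main
begin

datatype letter = LA | LB

definition apply_subst :: "('x \<Rightarrow> 'x list) \<Rightarrow> 'x list \<Rightarrow> 'x list" where
  "apply_subst s u = concat (map s u)"

fun sigma :: "nat \<Rightarrow> nat \<Rightarrow> nat \<Rightarrow> letter \<Rightarrow> letter list" where
  "sigma k l m LA = replicate k LA @ [LB] @ replicate l LA"
| "sigma k l m LB = replicate m LA"

definition word_limit :: "(nat \<Rightarrow> 'x list) \<Rightarrow> 'x word \<Rightarrow> bool" where
  "word_limit u w \<longleftrightarrow> (\<forall>i. eventually (\<lambda>n. i < length (u n) \<and> u n ! i = w i) sequentially)"

definition fixed_point :: "nat \<Rightarrow> nat \<Rightarrow> nat \<Rightarrow> letter word" where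
  "fixed_point k l m = (THE w. word_limit (\<lambda>n. (apply_subst (sigma k l m) ^^ n) [LA]) w)"

text \<open>Occurrences are counted from 1 and positions from 0, whereas \<^const>\<open>enumerate\<close> counts
  from 0; the value is meaningful when \<open>x\<close> occurs infinitely often in \<open>w\<close> and \<open>n \<ge> 1\<close>.\<close>
definition pos :: "'x word \<Rightarrow> 'x \<Rightarrow> nat \<Rightarrow> nat" where
  "pos w x n = enumerate {i. w i = x} (n - 1)"

definition r_word :: "letter word \<Rightarrow> nat \<Rightarrow> int" where
  "r_word w n = int (pos w LB n) - int (pos w LA n)"

definition delete_first :: "'x \<Rightarrow> 'x word \<Rightarrow> 'x word" where
  "delete_first x w = (\<lambda>i. if i < pos w x 1 then w i else w (Suc i))"

definition del_ab :: "letter word \<Rightarrow> letter word" where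
  "del_ab w = delete_first LB (delete_first LA w)"

text \<open>The limit defining \<^const>\<open>fixed_point\<close> exists and is unique for \<open>k, m \<ge> 1\<close>, so the
  definite description denotes it.\<close>

lemma word_limit_unique:
  assumes "word_limit u w" "word_limit u w'"
  shows "w = w'"
proof
  fix i
  have "eventually (\<lambda>n. i < length (u n) \<and> u n ! i = w i) sequentially"
    and "eventually (\<lambda>n. i < length (u n) \<and> u n ! i = w' i) sequentially"
    using assms unfolding word_limit_def by simp_all
  then have "eventually (\<lambda>n. u n ! i = w i \<and> u n ! i = w' i) sequentially"
    by eventually_elim simp
  then obtain n where "u n ! i = w i" "u n ! i = w' i"
    unfolding eventually_sequentially by blast
  then show "w i = w' i" by simp
qed

lemma word_limit_of_prefix_chain:
  assumes pre: "\<And>n. strict_prefix (u n) (u (Suc n))"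
  shows "word_limit u (\<lambda>i. u (Suc i) ! i)"
proof -
  have len: "n \<le> length (u n)" for n
  proof (induction n)
    case (Suc n)
    then show ?case using prefix_length_less[OF pre[of n]] by linarith
  qed simp
  have mono: "prefix (u n) (u m)" if "n \<le> m" for n m
    using that
  proof (induction m rule: dec_induct)
    case (step m)
    then show ?case using pre[of m] by (meson prefix_order.less_imp_le prefix_order.trans)
  qed simp
  have "i < length (u n) \<and> u n ! i = u (Suc i) ! i" if "Suc i \<le> n" for i n
    using mono[OF that] len[of "Suc i"] by (auto simp: prefix_def nth_append)
  then show ?thesis
    unfolding word_limit_def eventually_sequentially by blast
qed

lemma apply_subst_append: "apply_subst s (u @ v) = apply_subst s u @ apply_subst s v"
  by (simp add: apply_subst_def)

lemma apply_subst_power_append: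
  "(apply_subst s ^^ n) (u @ v) = (apply_subst s ^^ n) u @ (apply_subst s ^^ n) v"
  by (induction n) (simp_all add: apply_subst_append)

lemma word_limit_fixed_point:
  assumes "k \<ge> 1" "m \<ge> 1"
  shows "word_limit (\<lambda>n. (apply_subst (sigma k l m) ^^ n) [LA]) (fixed_point k l m)"
proof -
  let ?f = "apply_subst (sigma k l m)"
  have ne1: "?f u \<noteq> []" if "u \<noteq> []" for u
  proof (cases u)
    case (Cons x v)
    then show ?thesis using assms by (cases x) (auto simp: apply_subst_def)
  qed (use that in simp)
  have ne: "(?f ^^ n) u \<noteq> []" if "u \<noteq> []" for u n
    using that by (induction n) (simp_all add: ne1)
  have "strict_prefix ((?f ^^ n) [LA]) ((?f ^^ Suc n) [LA])" for n
  proof -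
    have "?f [LA] = [LA] @ (replicate (k - 1) LA @ [LB] @ replicate l LA)"
      using assms(1) by (cases k) (simp_all add: apply_subst_def)
    then have "(?f ^^ Suc n) [LA] = (?f ^^ n) ([LA] @ (replicate (k - 1) LA @ [LB] @ replicate l LA))"
      by (simp only: funpow_Suc_right o_apply)
    also have "\<dots> = (?f ^^ n) [LA] @ (?f ^^ n) (replicate (k - 1) LA @ [LB] @ replicate l LA)"
      by (rule apply_subst_power_append)
    finally show ?thesis
      using ne[of "replicate (k - 1) LA @ [LB] @ replicate l LA" n]
      by (simp add: strict_prefix_def)
  qed
  then have lim: "word_limit (\<lambda>n. (?f ^^ n) [LA]) (\<lambda>i. (?f ^^ Suc i) [LA] ! i)"
    by (rule word_limit_of_prefix_chain)
  have "fixed_point k l m = (\<lambda>i. (?f ^^ Suc i) [LA] ! i)"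
    unfolding fixed_point_def by (rule the_equality, rule lim, erule word_limit_unique[OF _ lim])
  then show ?thesis using lim by (simp only:)
qed

end

theory Submission
  imports Defs
begin

text \<open>The fixed point \<open>w\<close> of \<open>\<sigma> = \<sigma>\<^bsub>k,l,1\<^esub>\<close> satisfies \<open>\<sigma>(w) = w\<close>, and each \<open>a\<close> of \<open>w\<close> contributes
  exactly one \<open>b\<close> to \<open>\<sigma>(w)\<close>. If the \<open>n\<close>-th \<open>a\<close> is at position \<open>p\<close>, the prefix before it contains \<open>n - 1\<close>
  letters \<open>a\<close>, so its image has length \<open>p + (k + l) (n - 1)\<close>; the \<open>n\<close>-th \<open>b\<close> comes \<open>k\<close> letters later.
  If \<open>k = 1\<close>, then \<open>w\<close> starts with \<open>ab\<close>, so \<open>D\<close> removes the first two letters and \<open>r\<close> is just shifted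
  by one index. In the periodic word, the set of positions of \<open>b\<close> is that of \<open>a\<close> translated by \<open>j\<close>.\<close>

section \<open>Enumerations of infinite sets of naturals\<close>

lemma card_less_enumerate:
  fixes S :: "nat set"
  assumes "infinite S"
  shows "card {x \<in> S. x < enumerate S n} = n"
proof -
  have "{x \<in> S. x < enumerate S n} = enumerate S ` {..<n}"
  proof (intro subset_antisym subsetI)
    fix x assume "x \<in> {x \<in> S. x < enumerate S n}"
    moreover then obtain m where "enumerate S m = x"
      using enumerate_Ex[OF assms] by blast
    ultimately show "x \<in> enumerate S ` {..<n}"
      using enumerate_mono_iff[OF assms] by auto
  qed (use assms enumerate_in_set in auto)
  then show ?thesis
    using inj_enumerate[OF assms] by (simp add: card_image inj_on_subset)
qed

text \<open>Locates an occurrence: every element of \<open>S\<close> is enumerated at some index,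
  and counting the smaller elements reveals which.\<close>

lemma enumerate_eq_of_card_less:
  fixes S :: "nat set"
  assumes "infinite S" "i \<in> S" "card {x \<in> S. x < i} = n"
  shows "enumerate S n = i"
proof -
  obtain m where "enumerate S m = i"
    using enumerate_Ex assms by blast
  with card_less_enumerate[OF assms(1), of m] assms(3) show ?thesis by simp
qed

text \<open>A strictly monotone map keeps the number of smaller elements. It is applied to
  \<open>Suc\<close> and to translation by \<open>j\<close>.\<close>

lemma enumerate_strict_mono_image:
  fixes S :: "nat set" and f :: "nat \<Rightarrow> nat"
  assumes "infinite S" "strict_mono f"
  shows "enumerate (f ` S) n = f (enumerate S n)"
proof (rule enumerate_eq_of_card_less)
  have inj: "inj f" using assms(2) by (rule strict_mono_imp_inj_on)
  show "infinite (f ` S)"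
    using assms(1) inj by (simp add: finite_image_iff inj_on_subset)
  show "f (enumerate S n) \<in> f ` S"
    using assms(1) by (simp add: enumerate_in_set)
  have "{x \<in> f ` S. x < f (enumerate S n)} = f ` {x \<in> S. x < enumerate S n}"
    using strict_mono_less[OF assms(2)] by auto
  then show "card {x \<in> f ` S. x < f (enumerate S n)} = n"
    using inj by (simp add: card_image inj_on_subset card_less_enumerate[OF assms(1)])
qed

section \<open>Occurrences after dropping the first letter\<close>

lemma occurrences_tail: "{i. w i = x} - {0} = Suc ` {i. (w \<circ> Suc) i = x}"
proof (intro set_eqI)
  fix i
  show "i \<in> {i. w i = x} - {0} \<longleftrightarrow> i \<in> Suc ` {i. (w \<circ> Suc) i = x}"
    by (cases i) auto
qed

lemma infinite_occurrences_tail: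
  assumes "infinite {i. w i = x}"
  shows "infinite {i. (w \<circ> Suc) i = x}"
proof
  assume "finite {i. (w \<circ> Suc) i = x}"
  then have "finite ({i. w i = x} - {0})"
    unfolding occurrences_tail by (rule finite_imageI)
  with assms show False by simp
qed

lemma enumerate_occurrences_tail:
  assumes "infinite {i. w i = x}"
  shows "enumerate ({i. w i = x} - {0}) n = Suc (enumerate {i. (w \<circ> Suc) i = x} n)"
  unfolding occurrences_tail
  by (intro enumerate_strict_mono_image infinite_occurrences_tail[OF assms]) (simp add: strict_mono_def)

lemma pos_tail_neq:
  assumes "infinite {i. w i = x}" "w 0 \<noteq> x"
  shows "pos w x n = Suc (pos (w \<circ> Suc) x n)"
proof -
  have "{i. w i = x} - {0} = {i. w i = x}"
    using assms(2) by auto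
  then show ?thesis
    using enumerate_occurrences_tail[OF assms(1), of "n - 1"] unfolding pos_def by simp
qed

text \<open>The dropped letter is the first occurrence, so the index falls by one. At
  \<open>n = 0\<close> this would fail, because \<open>n - 1\<close> in \<open>pos\<close> is
  truncated.\<close>

lemma pos_tail_eq:
  assumes "infinite {i. w i = x}" "w 0 = x" "n \<ge> 1"
  shows "pos w x (Suc n) = Suc (pos (w \<circ> Suc) x n)"
proof -
  have "(LEAST i. i \<in> {i. w i = x}) = 0"
    using assms(2) by (intro Least_equality) auto
  then have "pos w x (Suc n) = enumerate ({i. w i = x} - {0}) (n - 1)"
    using assms(3) by (cases n) (simp_all add: pos_def enumerate_Suc del: mem_Collect_eq)
  then show ?thesis
    using enumerate_occurrences_tail[OF assms(1), of "n - 1"] unfolding pos_def by simp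
qed

lemma delete_first_eq_tail:
  assumes "w 0 = x"
  shows "delete_first x w = w \<circ> Suc"
proof -
  have "pos w x 1 = 0"
    using assms by (simp add: pos_def enumerate_0 Least_equality)
  then show ?thesis by (auto simp: delete_first_def)
qed

section \<open>Images of prefixes of a limit word\<close>

lemma prefix_map_upt:
  assumes "\<And>i. i < N \<Longrightarrow> i < length v \<and> v ! i = w i"
  shows "prefix (map w [0..<N]) v"
proof -
  have "N \<le> length v"
    using assms[of "N - 1"] by (cases N) auto
  then have "map w [0..<N] = take N v"
    using assms by (intro nth_equalityI) auto
  then show ?thesis by (simp add: take_is_prefix)
qed

text \<open>Expresses that \<open>s\<close> fixes \<open>w\<close> through finite prefixes: a late
  iterate begins with the prefix of length \<open>N\<close>, so the next iterate begins with its
  image.\<close>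

lemma word_limit_apply_subst:
  assumes "word_limit (\<lambda>n. (apply_subst s ^^ n) [a]) w"
    and i: "i < length (apply_subst s (map w [0..<N]))"
  shows "w i = apply_subst s (map w [0..<N]) ! i"
proof -
  let ?u = "\<lambda>n. (apply_subst s ^^ n) [a]"
  have ev: "eventually (\<lambda>n. i < length (?u n) \<and> ?u n ! i = w i) sequentially" for i
    using assms(1) unfolding word_limit_def by blast
  have "eventually (\<lambda>n. \<forall>i\<in>{..<N}. i < length (?u n) \<and> ?u n ! i = w i) sequentially"
    by (intro eventually_ball_finite) (use ev in auto)
  \<comment> \<open>Shifting the index lets one \<open>n\<close> serve for both consecutive
    iterates.\<close>
  moreover have "eventually (\<lambda>n. i < length (?u (Suc n)) \<and> ?u (Suc n) ! i = w i) sequentially"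
    using ev[of i] by (subst eventually_sequentially_Suc)
  ultimately have "eventually (\<lambda>n. (\<forall>i\<in>{..<N}. i < length (?u n) \<and> ?u n ! i = w i) \<and>
      ?u (Suc n) ! i = w i) sequentially"
    by eventually_elim simp
  then obtain n where n: "\<forall>i\<in>{..<N}. i < length (?u n) \<and> ?u n ! i = w i" "?u (Suc n) ! i = w i"
    unfolding eventually_sequentially by blast
  have "prefix (map w [0..<N]) (?u n)"
    using n(1) by (intro prefix_map_upt) auto
  then obtain v where "?u n = map w [0..<N] @ v"
    by (auto simp: prefix_def)
  then have "?u (Suc n) = apply_subst s (map w [0..<N]) @ apply_subst s v"
    by (simp add: apply_subst_append)
  then show ?thesis
    using n(2) i by (simp add: nth_append)
qed

lemma count_list_map_upt: "count_list (map w [0..<N]) x = card {i. w i = x \<and> i < N}"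
  by (auto simp: count_list_eq_length_filter length_filter_conv_card intro: arg_cong[where f = card])

lemma count_list_replicate: "count_list (replicate n y) x = (if x = y then n else 0)"
  by (induction n) auto

text \<open>For \<open>m = 1\<close> the image of \<open>LB\<close> has length 1, so only
  \<open>LA\<close> lengthens a word, by \<open>k + l\<close>.\<close>

lemma length_apply_sigma:
  "length (apply_subst (sigma k l 1) u) = length u + (k + l) * count_list u LA"
proof (induction u)
  case (Cons x u)
  then show ?case by (cases x) (auto simp: apply_subst_def)
qed (simp add: apply_subst_def)

lemma count_LB_apply_sigma:
  "count_list (apply_subst (sigma k l m) u) LB = count_list u LA"
proof (induction u)
  case (Cons x u)
  then show ?case by (cases x) (auto simp: apply_subst_def count_list_replicate)
qed (simp add: apply_subst_def)

section \<open>The fixed point for \<open>m = 1\<close>\<close>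

context
  fixes k l :: nat and w :: "letter word"
  assumes k: "k \<ge> 1" and w: "w = fixed_point k l 1"
begin

lemma fixed_point_nth:
  assumes "i < length (apply_subst (sigma k l 1) (map w [0..<N]))"
  shows "w i = apply_subst (sigma k l 1) (map w [0..<N]) ! i"
  using word_limit_apply_subst[OF word_limit_fixed_point[OF k, of 1 l, folded w]] assms by simp

lemma fixed_point_0: "w 0 = LA"
proof -
  have "w 0 = apply_subst (sigma k l 1) (map w [0..<1]) ! 0"
    by (rule fixed_point_nth) (simp only: length_apply_sigma, simp)
  \<comment> \<open>The image of either letter begins with \<open>LA\<close>; for \<open>LA\<close>
    itself this needs \<open>k \<ge> 1\<close>.\<close>
  then show ?thesis
    using k by (cases "w 0") (auto simp: apply_subst_def nth_append)
qed

lemma fixed_point_image_LA: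
  assumes "w p = LA" "card {i. w i = LA \<and> i < p} = n" and q: "q = p + (k + l) * n + k"
  shows "w q = LB" "card {i. w i = LB \<and> i < q} = n"
proof -
  let ?u = "map w [0..<p]" and ?s = "apply_subst (sigma k l 1)"
  have cnt: "count_list ?u LA = n"
    using assms(2) by (simp add: count_list_map_upt)
  have len: "length (?s ?u) = p + (k + l) * n"
    unfolding length_apply_sigma cnt by simp
  \<comment> \<open>Bracketed so that the part before the \<open>LB\<close> coming from position
    \<open>p\<close> has length exactly \<open>q\<close>.\<close>
  have img: "?s (map w [0..<Suc p]) = (?s ?u @ replicate k LA) @ LB # replicate l LA"
    using assms(1) by (simp add: apply_subst_def)
  have lq: "q = length (?s ?u @ replicate k LA)"
    using len q by simp
  have lt: "q < length (?s (map w [0..<Suc p]))"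
    unfolding img using lq by simp
  show "w q = LB"
    using fixed_point_nth[OF lt] unfolding img lq nth_append_length .
  have "map w [0..<q] = ?s ?u @ replicate k LA"
  proof (rule nth_equalityI)
    fix i assume "i < length (map w [0..<q])"
    then have "i < q" by simp
    then show "map w [0..<q] ! i = (?s ?u @ replicate k LA) ! i"
      using fixed_point_nth[of i "Suc p"] lt lq
      unfolding img by (simp add: nth_append_left del: append_assoc)
  qed (use lq in simp)
  then show "card {i. w i = LB \<and> i < q} = n"
    using count_list_map_upt[of w q LB] cnt
    by (simp add: count_LB_apply_sigma count_list_replicate)
qed

text \<open>If \<open>LB\<close> stands at \<open>N\<close>, its image is a single
  \<open>LA\<close>, at a position no earlier than \<open>N\<close>.\<close>

lemma infinite_LA: "infinite {i. w i = LA}"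
  unfolding infinite_nat_iff_unbounded_le
proof
  fix N
  show "\<exists>i\<ge>N. i \<in> {i. w i = LA}"
  proof (cases "w N")
    case LB
    let ?u = "map w [0..<N]" and ?s = "apply_subst (sigma k l 1)"
    have img: "?s (map w [0..<Suc N]) = ?s ?u @ [LA]"
      using LB by (simp add: apply_subst_def)
    have "w (length (?s ?u)) = LA"
      using fixed_point_nth[of "length (?s ?u)" "Suc N"] unfolding img by simp
    moreover have "N \<le> length (?s ?u)"
      unfolding length_apply_sigma by simp
    ultimately show ?thesis by blast
  qed auto
qed

lemma infinite_LB: "infinite {i. w i = LB}"
  unfolding infinite_nat_iff_unbounded_le
proof
  fix N
  obtain p where "p \<ge> N" "w p = LA"
    using infinite_LA unfolding infinite_nat_iff_unbounded_le by blast
  then show "\<exists>i\<ge>N. i \<in> {i. w i = LB}"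
    using fixed_point_image_LA(1)[OF _ refl refl, of p]
    by (intro exI[of _ "p + (k + l) * card {i. w i = LA \<and> i < p} + k"]) auto
qed

lemma r_word_fixed_point:
  assumes "n \<ge> 1"
  shows "r_word w n = int (k + l) * int n - int l"
proof -
  let ?p = "pos w LA n"
  have "w ?p = LA"
    using enumerate_in_set[OF infinite_LA] by (simp add: pos_def)
  moreover have "card {i. w i = LA \<and> i < ?p} = n - 1"
    using card_less_enumerate[OF infinite_LA] by (simp add: pos_def)
  \<comment> \<open>Before the \<open>n\<close>-th occurrence there are \<open>n - 1\<close> others,
    for either letter.\<close>
  ultimately have "pos w LB n = ?p + (k + l) * (n - 1) + k"
    using fixed_point_image_LA[OF _ _ refl, of ?p "n - 1"] infinite_LB
    unfolding pos_def[of w LB] by (intro enumerate_eq_of_card_less) auto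
  then show ?thesis
    using assms by (cases n) (simp_all add: r_word_def algebra_simps)
qed

end

section \<open>Effect of \<open>del_ab\<close>, the periodic word, and the three claims\<close>

lemma r_word_del_ab:
  assumes "w 0 = LA" "w 1 = LB" "infinite {i. w i = LA}" "infinite {i. w i = LB}" "n \<ge> 1"
  shows "r_word (del_ab w) n = r_word w (Suc n)"
proof -
  let ?v = "w \<circ> Suc"
  \<comment> \<open>Deleting the \<open>LA\<close> at 0 brings the first \<open>LB\<close> to
    position 0, so the second deletion also drops a first letter.\<close>
  have v0: "?v 0 = LB" using assms(2) by simp
  have del: "del_ab w = ?v \<circ> Suc"
    unfolding del_ab_def delete_first_eq_tail[of w, OF assms(1)]
    by (rule delete_first_eq_tail[of ?v, OF v0])
  have "pos w LA (Suc n) = Suc (Suc (pos (del_ab w) LA n))"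
    unfolding del pos_tail_eq[OF assms(3,1,5)]
    using pos_tail_neq[of ?v, OF infinite_occurrences_tail[OF assms(3)]] v0 by simp
  moreover have "pos w LB (Suc n) = Suc (Suc (pos (del_ab w) LB n))"
    unfolding del using pos_tail_neq[OF assms(4), of "Suc n"] assms(1)
      pos_tail_eq[of ?v, OF infinite_occurrences_tail[OF assms(4)] v0 assms(5)] by simp
  ultimately show ?thesis by (simp add: r_word_def)
qed

lemma r_word_periodic:
  assumes "j \<ge> 1"
  shows "r_word ((replicate j LA @ replicate j LB)\<^sup>\<omega>) n = int j"
proof -
  let ?w = "(replicate j LA @ replicate j LB)\<^sup>\<omega>"
  have val: "?w i = (if i mod (2 * j) < j then LA else LB)" for i
  proof -
    have "i mod (2 * j) < 2 * j" using assms by simp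
    then show ?thesis using assms
      by (auto simp: iter_def nth_append mult_2[symmetric] less_diff_conv2)
  qed
  have A: "{i. ?w i = LA} = {i. i mod (2 * j) < j}"
    unfolding val by auto
  have B: "{i. ?w i = LB} = (\<lambda>i. i + j) ` {i. ?w i = LA}"
  proof (intro set_eqI iffI)
    fix i assume "i \<in> {i. ?w i = LB}"
    then have ge: "j \<le> i mod (2 * j)" unfolding val by (auto split: if_splits)
    have lt: "i mod (2 * j) < 2 * j" using assms by simp
    \<comment> \<open>The remainder is at least \<open>j\<close>, so subtracting \<open>j\<close>
      stays within the same period.\<close>
    have "i - j = 2 * j * (i div (2 * j)) + (i mod (2 * j) - j)"
      using ge mult_div_mod_eq[of "2 * j" i] by linarith
    then have "(i - j) mod (2 * j) = i mod (2 * j) - j"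
      using lt by simp
    moreover have "j \<le> i" using ge mod_less_eq_dividend order_trans by blast
    ultimately show "i \<in> (\<lambda>i. i + j) ` {i. ?w i = LA}"
      unfolding A using lt by (intro image_eqI[of _ _ "i - j"]) auto
  next
    fix i assume "i \<in> (\<lambda>i. i + j) ` {i. ?w i = LA}"
    then obtain p where p: "i = p + j" "p mod (2 * j) < j" unfolding A by auto
    have "i mod (2 * j) = (p mod (2 * j) + j) mod (2 * j)"
      unfolding p(1) by (simp add: mod_add_left_eq)
    then show "i \<in> {i. ?w i = LB}" unfolding val using p(2) by simp
  qed
  have inf: "infinite {i. ?w i = LA}"
    unfolding A infinite_nat_iff_unbounded_le
  proof
    fix N
    show "\<exists>i\<ge>N. i \<in> {i. i mod (2 * j) < j}"
      using assms by (intro exI[of _ "2 * j * N"]) auto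
  qed
  have "pos ?w LB n = pos ?w LA n + j"
    unfolding pos_def B using inf
    by (intro enumerate_strict_mono_image) (auto simp: strict_mono_def)
  then show ?thesis by (simp add: r_word_def)
qed

lemma r_word_del_ab_fixed_point:
  assumes "n \<ge> 1"
  shows "r_word (del_ab (fixed_point 1 l 1)) n = int (Suc l) * int n + 1"
proof -
  let ?w = "fixed_point 1 l 1"
  have "?w 0 = LA" by (rule fixed_point_0[OF _ refl]) simp
  moreover from this have "?w 1 = LB"
    \<comment> \<open>The \<open>LA\<close> at position 0 has no \<open>LA\<close> before it, and
      \<open>k = 1\<close> puts its \<open>LB\<close> at position 1.\<close>
    using fixed_point_image_LA(1)[of 1 ?w l 0 0 1] by simp
  moreover have "infinite {i. ?w i = LA}" "infinite {i. ?w i = LB}"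
    using infinite_LA[OF _ refl] infinite_LB[OF _ refl] by simp_all
  ultimately have "r_word (del_ab ?w) n = r_word ?w (Suc n)"
    using assms by (rule r_word_del_ab)
  \<comment> \<open>Here \<open>(1 + l) * (n + 1) - l = (1 + l) * n + 1\<close>.\<close>
  then show ?thesis
    using r_word_fixed_point[of 1 ?w l "Suc n"] by (simp add: algebra_simps)
qed

theorem theorem5p1:
  shows "(\<forall>j::nat. 1 \<le> j \<longrightarrow>
            (\<forall>n::nat. 1 \<le> n \<longrightarrow> r_word ((replicate j LA @ replicate j LB)\<^sup>\<omega>) n = int j)) \<and>
         (\<forall>k j::nat. 1 \<le> k \<and> j \<le> k - 1 \<longrightarrow>
            (\<forall>n::nat. 1 \<le> n \<longrightarrow> r_word (fixed_point (k - j) j 1) n = int k * int n - int j)) \<and>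
         (\<forall>k::nat. 1 \<le> k \<longrightarrow>
            (\<forall>n::nat. 1 \<le> n \<longrightarrow> r_word (del_ab (fixed_point 1 (k - 1) 1)) n = int k * int n + 1))"
proof (intro conjI allI impI)
  fix j n :: nat assume "1 \<le> j"
  then show "r_word ((replicate j LA @ replicate j LB)\<^sup>\<omega>) n = int j"
    by (rule r_word_periodic)
next
  fix k j n :: nat assume "1 \<le> k \<and> j \<le> k - 1" "1 \<le> n"
  moreover from this have "1 \<le> k - j" by linarith
  ultimately show "r_word (fixed_point (k - j) j 1) n = int k * int n - int j"
    using r_word_fixed_point[OF _ refl, of "k - j" n j] by simp
next
  fix k n :: nat assume "1 \<le> k" "1 \<le> n"
  then show "r_word (del_ab (fixed_point 1 (k - 1) 1)) n = int k * int n + 1"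
    using r_word_del_ab_fixed_point[of n "k - 1"] by simp
qed

end
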